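(* For every digraph $D$ with $w(P(D))\ge 2$, one has $l^*(D)\le w(P(D))$.
   Context: A digraph $D$ is finite with nonempty vertex set $V(D)$; loops are allowed, no multiple edges. Trees are finite; a leaf is a vertex of degree 1. Subtrees are nonempty connected subgraphs. A catch-tree representation of $D$ in a host tree $T$ assigns to each vertex $v$ of $D$ a subtree $S_v$ of $T$ (source subtree) and a single vertex $t_v$ of $T$ (sink point) such that, for all $u,v\in V(D)$ (including $u=v$), $uv$ is an edge of $D$ if and only if $t_v\in S_u$. The catch leafage $l^*(D)$ is the minimum number of leaves of a host tree in which $D$ has a catch-tree representation. The incidence poset $P(D)$ is the collection of predecessor sets $N^-(v)=\{u\in V(D): uv\in E(D)\}$, $v\in V(D)$, ordered by inclusion (these are the sets whose incidence vectors are the columns of the adjacency matrix; equal sets give one element). The width $w(P)$ of a poset $P$ is the maximum size of an antichain in $P$. *)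

theory Defs
  imports "Graph_Theory.Graph_Theory"
begin

text \<open>
  A finite undirected graph is a finite symmetric loop-free digraph (\<^locale>\<open>pair_graph\<close>).
  The constant \<^const>\<open>tree\<close> of the library is not the undirected notion: for a symmetric digraph
  the closed walk \<open>a, b, a\<close> is a \<open>cycle\<close>. The cycles of an undirected graph are those with at
  least three arcs.
\<close>

definition undirected_tree :: "'a pair_pre_digraph \<Rightarrow> bool" where
  "undirected_tree T \<longleftrightarrow> pair_graph T \<and> connected (with_proj T)
     \<and> \<not> (\<exists>p. pre_digraph.cycle (with_proj T) p \<and> 3 \<le> length p)"

text \<open>Each undirected edge at \<open>v\<close> contributes exactly one outgoing arc, so the out-degree is the degree.\<close>

definition leaves :: "'a pair_pre_digraph \<Rightarrow> 'a set" where
  "leaves T = {v \<in> pverts T. out_degree (with_proj T) v = 1}"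

text \<open>
  Symmetry makes the subgraph undirected; \<^const>\<open>connected\<close> includes having a vertex.
\<close>

definition subtree :: "'a pair_pre_digraph \<Rightarrow> 'a pair_pre_digraph \<Rightarrow> bool" where
  "subtree H T \<longleftrightarrow> subgraph (with_proj H) (with_proj T) \<and> symmetric (with_proj H)
     \<and> connected (with_proj H)"

definition catch_tree_rep ::
  "'v pair_pre_digraph \<Rightarrow> 'a pair_pre_digraph \<Rightarrow> ('v \<Rightarrow> 'a pair_pre_digraph) \<Rightarrow> ('v \<Rightarrow> 'a) \<Rightarrow> bool" where
  "catch_tree_rep D T S t \<longleftrightarrow>
     (\<forall>v \<in> pverts D. subtree (S v) T \<and> t v \<in> pverts T) \<and>
     (\<forall>u \<in> pverts D. \<forall>v \<in> pverts D. (u, v) \<in> parcs D \<longleftrightarrow> t v \<in> pverts (S u))"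

text \<open>
  Host trees are finite, so it is no restriction to take their vertices in \<^typ>\<open>nat\<close>.
  Every finite digraph has a representation, so the minimum is over a nonempty set; \<open>LEAST\<close> over an
  empty one would be an unspecified number, not 0.
\<close>

definition catch_leafage :: "'v pair_pre_digraph \<Rightarrow> nat" where
  "catch_leafage D = (LEAST k. \<exists>(T :: nat pair_pre_digraph) S t.
     undirected_tree T \<and> catch_tree_rep D T S t \<and> card (leaves T) = k)"

definition predecessors :: "'v pair_pre_digraph \<Rightarrow> 'v \<Rightarrow> 'v set" where
  "predecessors D v = {u \<in> pverts D. (u, v) \<in> parcs D}"

text \<open>The order is inclusion, i.e. the order of type \<^typ>\<open>'v set\<close>.\<close>

definition incidence_poset :: "'v pair_pre_digraph \<Rightarrow> 'v set set" where
  "incidence_poset D = predecessors D ` pverts D"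

definition antichain :: "'a::order set \<Rightarrow> bool" where
  "antichain A \<longleftrightarrow> (\<forall>x \<in> A. \<forall>y \<in> A. x \<le> y \<longrightarrow> x = y)"

text \<open>For finite \<open>P\<close>; otherwise the cardinalities may be unbounded and \<open>Max\<close> unspecified.\<close>

definition width :: "'a::order set \<Rightarrow> nat" where
  "width P = Max {card A | A. A \<subseteq> P \<and> antichain A}"

end

theory Submission
  imports Defs
begin

text \<open>
  By Dilworth's theorem the incidence poset splits into \<open>w\<close> chains. The host tree is a spider with
  one leg for each chain, whose vertices are the members of the chain with the largest one next to
  the centre; as \<open>w \<ge> 2\<close>, the centre is not a leaf. The sink point of \<open>v\<close> is the vertex of
  \<open>N\<^sup>-(v)\<close>, and the source subtree of \<open>u\<close> consists of the centre and all sets that contain \<open>u\<close>;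
  these form an initial segment of each leg.
\<close>

section \<open>Dilworth's theorem\<close>

text \<open>An antichain meets each chain, here a colour class of \<open>f\<close>, at most
  once.\<close>

lemma antichain_inj_on_chain_cover:
  assumes "antichain A" "\<And>x y. x \<in> A \<Longrightarrow> y \<in> A \<Longrightarrow> f x = f y \<Longrightarrow> x \<le> y \<or> y \<le> x"
  shows "inj_on f A"
  using assms by (metis antichain_def inj_onI)

text \<open>Galvin's induction: remove a maximal element.\<close>

lemma dilworth:
  fixes P :: "'a::order set"
  assumes "finite P" and "\<And>A. A \<subseteq> P \<Longrightarrow> antichain A \<Longrightarrow> card A \<le> k"
  shows "\<exists>f::'a \<Rightarrow> nat. f ` P \<subseteq> {..<k} \<and> (\<forall>x\<in>P. \<forall>y\<in>P. f x = f y \<longrightarrow> x \<le> y \<or> y \<le> x)"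
  using assms
proof (induction "card P" arbitrary: P k rule: less_induct)
  case less
  note fin = \<open>finite P\<close> and ac = less.prems(2)
  show ?case
  proof (cases "P = {}")
    case False
    obtain a where a: "a \<in> P" and a_max: "\<And>b. b \<in> P \<Longrightarrow> a \<le> b \<Longrightarrow> a = b"
      using finite_has_maximal[OF fin False] by blast
    have "card {a} \<le> k"
      by (rule ac) (use a in \<open>auto simp: antichain_def\<close>)
    then obtain m where k: "k = Suc m"
      by (cases k) auto
    text \<open>It suffices to remove a chain that meets every antichain of maximal size.\<close>
    have remove_chain: ?thesis
      if "a \<in> K" and chain: "\<And>x y. x \<in> K \<Longrightarrow> y \<in> K \<Longrightarrow> x \<le> y \<or> y \<le> x"
        and small: "\<And>A. A \<subseteq> P - K \<Longrightarrow> antichain A \<Longrightarrow> card A \<noteq> k" for K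
    proof -
      have "card (P - K) < card P"
        using that(1) a fin by (intro psubset_card_mono) auto
      moreover have "card A \<le> m" if "A \<subseteq> P - K" "antichain A" for A
        using ac[of A] small[of A] that k by fastforce
      ultimately obtain f :: "'a \<Rightarrow> nat" where f: "f ` (P - K) \<subseteq> {..<m}"
        and fchain: "\<forall>x\<in>P-K. \<forall>y\<in>P-K. f x = f y \<longrightarrow> x \<le> y \<or> y \<le> x"
        using less.hyps[of "P - K" m] fin by blast
      \<comment> \<open>The colouring \<open>f\<close> uses only colours below \<open>m\<close>, so
        \<open>m\<close> is free for the chain \<open>K\<close>.\<close>
      define g where "g x = (if x \<in> K then m else f x)" for x
      have "g ` P \<subseteq> {..<k}"
        using f k by (auto simp: g_def less_Suc_eq)
      moreover have "x \<le> y \<or> y \<le> x" if "x \<in> P" "y \<in> P" "g x = g y" for x y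
      proof (cases "x \<in> K \<or> y \<in> K")
        case True
        then have "x \<in> K \<and> y \<in> K"
          using that f by (auto simp: g_def split: if_splits)
        then show ?thesis
          using chain by blast
      next
        case False
        then show ?thesis
          using that fchain by (simp add: g_def)
      qed
      ultimately show ?thesis
        by blast
    qed
    define P' where "P' = P - {a}"
    have "card P' < card P"
      unfolding P'_def using a fin by (rule card_Diff1_less[rotated])
    then obtain f :: "'a \<Rightarrow> nat" where f: "f ` P' \<subseteq> {..<k}"
      and fchain: "\<And>x y. x \<in> P' \<Longrightarrow> y \<in> P' \<Longrightarrow> f x = f y \<Longrightarrow> x \<le> y \<or> y \<le> x"
      using less.hyps[of P' k] ac fin unfolding P'_def by (smt (verit) Diff_subset finite_Diff subset_trans)
    define big where "big A \<longleftrightarrow> A \<subseteq> P' \<and> antichain A \<and> card A = k" for A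
    \<comment> \<open>A big antichain has as many members as there are colours, so it meets every
      colour class.\<close>
    have image_big: "f ` A = {..<k}" if "big A" for A
    proof -
      have "inj_on f A"
        using that fchain unfolding big_def by (intro antichain_inj_on_chain_cover) auto
      then have "card (f ` A) = k"
        using that by (simp add: card_image big_def)
      moreover have "f ` A \<subseteq> {..<k}"
        using that f by (auto simp: big_def)
      ultimately show ?thesis
        by (intro card_subset_eq) auto
    qed
    show ?thesis
    proof (cases "\<exists>A. big A")
      case False
      show ?thesis
      \<comment> \<open>With no antichain of size \<open>k\<close> left in \<open>P'\<close>, the
        single element \<open>a\<close> already meets all of them.\<close>
      proof (rule remove_chain[of "{a}"])
        show "card A \<noteq> k" if "A \<subseteq> P - {a}" "antichain A" for A
          using False that by (auto simp: big_def P'_def)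
      qed auto
    next
      case True
      \<comment> \<open>\<open>C i\<close> is the part of chain \<open>i\<close> that lies on big
        antichains. It is nonempty for \<open>i < k\<close>, and its top \<open>t i\<close> is
        chosen below.\<close>
      define C where "C i = {x \<in> \<Union>{A. big A}. f x = i}" for i
      have C_P': "C i \<subseteq> P'" for i
        by (auto simp: C_def big_def)
      have "\<exists>x\<in>C i. \<forall>y\<in>C i. y \<le> x" if "i < k" for i
      proof -
        obtain A where A: "big A"
          using True by blast
        then have "i \<in> f ` A"
          using image_big that by simp
        then have "C i \<noteq> {}"
          using A unfolding C_def by blast
        moreover have "finite (C i)"
          using C_P' fin by (metis P'_def finite_Diff finite_subset)
        ultimately obtain x where "x \<in> C i" "\<And>y. y \<in> C i \<Longrightarrow> x \<le> y \<Longrightarrow> x = y"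
          using finite_has_maximal[of "C i"] by blast
        moreover have "y \<le> x \<or> x \<le> y" if "y \<in> C i" for y
          using fchain[of y x] that \<open>x \<in> C i\<close> C_P'[of i] by (auto simp: C_def)
        ultimately show ?thesis
          by (metis order_refl)
      qed
      then obtain t where t: "\<And>i. i < k \<Longrightarrow> t i \<in> C i"
        and t_top: "\<And>i y. i < k \<Longrightarrow> y \<in> C i \<Longrightarrow> y \<le> t i"
        by metis
      have f_t: "f (t i) = i" if "i < k" for i
        using t[OF that] by (simp add: C_def)
      \<comment> \<open>A big antichain through \<open>t j\<close> has a member \<open>y\<close> of
        colour \<open>i\<close>. Then \<open>y \<le> t i \<le> t j\<close> forces
        \<open>y = t j\<close>, so the colours agree.\<close>
      have t_antichain: "i = j" if ij: "i < k" "j < k" and le: "t i \<le> t j" for i j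
      proof -
        obtain A where A: "big A" "t j \<in> A"
          using t[OF ij(2)] by (auto simp: C_def)
        then obtain y where y: "y \<in> A" "f y = i"
          using image_big[OF A(1)] ij(1) by (metis imageE lessThan_iff)
        then have "y \<le> t i"
          using t_top[OF ij(1)] A(1) by (auto simp: C_def)
        then have "y = t j"
          using le y(1) A by (meson big_def antichain_def order_trans)
        then show ?thesis
          using f_t[OF ij(2)] y(2) by simp
      qed
      \<comment> \<open>Otherwise \<open>a\<close> is incomparable to every top, since its
        maximality excludes \<open>a \<le> t i\<close>, and adding it to the tops gives an antichain
        of size \<open>k + 1\<close>.\<close>
      have "\<exists>i<k. t i \<le> a"
      proof (rule ccontr)
        assume none: "\<not> (\<exists>i<k. t i \<le> a)"
        have t_P': "t ` {..<k} \<subseteq> P'"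
          using t C_P' by blast
        have "antichain (insert a (t ` {..<k}))"
          unfolding antichain_def
        proof (intro ballI impI)
          fix x y assume xy: "x \<in> insert a (t ` {..<k})" "y \<in> insert a (t ` {..<k})" "x \<le> y"
          consider "x = a" | "y = a" "x \<noteq> a" | i j where "i < k" "j < k" "x = t i" "y = t j"
            using xy by blast
          then show "x = y"
          proof cases
            case 1
            then show ?thesis
              using xy a_max t_P' a unfolding P'_def by blast
          next
            case 2
            then show ?thesis
              using xy none by blast
          next
            case 3
            then show ?thesis
              using t_antichain xy by blast
          qed
        qed
        moreover have "insert a (t ` {..<k}) \<subseteq> P"
          using t_P' a unfolding P'_def by blast
        ultimately have "card (insert a (t ` {..<k})) \<le> k"
          using ac by blast
        moreover have "inj_on t {..<k}"
          using f_t by (metis inj_onI lessThan_iff)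
        then have "card (insert a (t ` {..<k})) = Suc k"
          using t_P' by (subst card_insert_disjoint) (auto simp: P'_def card_image)
        ultimately show False
          by simp
      qed
      then obtain i where i: "i < k" "t i \<le> a"
        by blast
      show ?thesis
      proof (rule remove_chain)
        \<comment> \<open>The removed chain is \<open>a\<close> on top of the part of chain
          \<open>i\<close> up to \<open>t i\<close>. An antichain of size \<open>k\<close> that
          avoids \<open>a\<close> is big, and its member of colour \<open>i\<close> lies in
          \<open>C i\<close>, hence in this chain.\<close>
        let ?K = "insert a {z \<in> P'. f z = i \<and> z \<le> t i}"
        show "a \<in> ?K"
          by simp
        show "x \<le> y \<or> y \<le> x" if "x \<in> ?K" "y \<in> ?K" for x y
          using that fchain i(2) by (auto intro: order_trans)
        show "card A \<noteq> k" if A: "A \<subseteq> P - ?K" "antichain A" for A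
        proof
          assume "card A = k"
          with A have "big A"
            by (auto simp: big_def P'_def)
          then obtain y where y: "y \<in> A" "f y = i"
            using image_big[of A] i(1) by (metis imageE lessThan_iff)
          then have "y \<le> t i"
            using t_top[OF i(1)] \<open>big A\<close> by (auto simp: C_def)
          then show False
            using y A(1) \<open>big A\<close> by (auto simp: big_def)
        qed
      qed
    qed
  qed auto
qed

lemma width_greatest:
  assumes "finite P"
  shows "\<exists>A\<subseteq>P. antichain A \<and> card A = width P"
    and "A \<subseteq> P \<Longrightarrow> antichain A \<Longrightarrow> card A \<le> width P"
proof -
  let ?S = "{card A | A. A \<subseteq> P \<and> antichain A}"
  have "?S \<subseteq> card ` Pow P"
    by blast
  then have fin: "finite ?S"
    using assms by (meson finite_Pow_iff finite_imageI finite_subset)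
  \<comment> \<open>The empty antichain keeps \<open>Max\<close> from being taken over the empty
    set.\<close>
  have "card {} \<in> ?S"
    by (auto simp: antichain_def intro!: exI[of _ "{}"])
  then have "Max ?S \<in> ?S"
    using fin by (intro Max_in) auto
  then show "\<exists>A\<subseteq>P. antichain A \<and> card A = width P"
    unfolding width_def by (smt (verit) mem_Collect_eq)
  show "card A \<le> width P" if "A \<subseteq> P" "antichain A"
    unfolding width_def by (rule Max_ge[OF fin]) (use that in blast)
qed

text \<open>A largest antichain receives pairwise different colours, so all \<open>width P\<close>
  colours occur. This later makes the number of legs of the spider exactly
  \<open>width P\<close>.\<close>

corollary chain_partition:
  fixes P :: "'a::order set"
  assumes "finite P"
  shows "\<exists>f::'a \<Rightarrow> nat. f ` P = {..<width P} \<and>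
    (\<forall>x\<in>P. \<forall>y\<in>P. f x = f y \<longrightarrow> x \<le> y \<or> y \<le> x)"
proof -
  obtain f :: "'a \<Rightarrow> nat" where f: "f ` P \<subseteq> {..<width P}"
    and chain: "\<forall>x\<in>P. \<forall>y\<in>P. f x = f y \<longrightarrow> x \<le> y \<or> y \<le> x"
    using dilworth[OF assms width_greatest(2)[OF assms]] by blast
  obtain A where A: "A \<subseteq> P" "antichain A" "card A = width P"
    using width_greatest(1)[OF assms] by blast
  have "inj_on f A"
    using A chain by (intro antichain_inj_on_chain_cover) auto
  then have "width P = card (f ` A)"
    using A by (simp add: card_image)
  also have "\<dots> \<le> card (f ` P)"
    using A(1) assms by (intro card_mono) auto
  finally have "f ` P = {..<width P}"
    using f by (intro card_subset_eq) (auto intro: antisym surj_card_le dest: card_mono[rotated])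
  with chain show ?thesis
    by blast
qed

text \<open>Supplies the vertex numbers of the spider: larger sets get smaller numbers and so lie
  closer to the centre, for which 0 is kept free. A minimal element can always take the last
  number.\<close>

lemma reverse_linear_extension:
  fixes P :: "'a::order set"
  assumes "finite P"
  shows "\<exists>e::'a \<Rightarrow> nat. bij_betw e P {1..card P} \<and> (\<forall>x\<in>P. \<forall>y\<in>P. x < y \<longrightarrow> e y < e x)"
  using assms
proof (induction "card P" arbitrary: P)
  case 0
  then show ?case
    by (auto simp: bij_betw_def)
next
  case (Suc n)
  then obtain a where a: "a \<in> P" and a_min: "\<And>b. b \<in> P \<Longrightarrow> b \<le> a \<Longrightarrow> a = b"
    using finite_has_minimal[of P] by (metis card.empty nat.distinct(1))
  have n: "card (P - {a}) = n"
    using Suc a by simp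
  then obtain e :: "'a \<Rightarrow> nat" where e: "bij_betw e (P - {a}) {1..n}"
    and mono: "\<forall>x\<in>P-{a}. \<forall>y\<in>P-{a}. x < y \<longrightarrow> e y < e x"
    using Suc(1)[of "P - {a}"] Suc.prems by blast
  let ?e = "e(a := Suc n)"
  have "bij_betw ?e (P - {a}) {1..n}"
    using e by (subst bij_betw_cong[where g = e]) auto
  then have "bij_betw ?e (insert a (P - {a})) (insert (Suc n) {1..n})"
    using notIn_Un_bij_betw[of a "P - {a}" ?e "{1..n}"] by simp
  then have "bij_betw ?e P {1..card P}"
    using a Suc.hyps(2) by (metis One_nat_def atLeastAtMostSuc_conv insert_Diff le_add1 plus_1_eq_Suc)
  moreover have "?e y < ?e x" if "x \<in> P" "y \<in> P" "x < y" for x y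
  proof (cases "x = a")
    case True
    then have "e y \<in> {1..n}"
      using that e by (auto simp: bij_betw_def)
    then show ?thesis
      using True that by auto
  next
    case False
    moreover have "y \<noteq> a"
      using that a_min[of x] by (auto dest: less_imp_le)
    ultimately show ?thesis
      using mono that by simp
  qed
  ultimately show ?case
    by blast
qed

section \<open>Trees given by a parent function\<close>

text \<open>The strict inequalities exclude loops and make the value of \<open>p\<close> at 0
  irrelevant, so 0 acts as the root. Listing both orientations makes the graph symmetric.\<close>

definition parent_graph :: "(nat \<Rightarrow> nat) \<Rightarrow> nat set \<Rightarrow> nat pair_pre_digraph" where
  "parent_graph p A = \<lparr>pverts = A,
     parcs = {(x, y) \<in> A \<times> A. p y = x \<and> x < y \<or> p x = y \<and> y < x}\<rparr>"

text \<open>These vertex sets induce connected graphs; the condition serves for the host tree and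
  for its subtrees alike.\<close>

definition parent_closed :: "(nat \<Rightarrow> nat) \<Rightarrow> nat set \<Rightarrow> bool" where
  "parent_closed p A \<longleftrightarrow> 0 \<in> A \<and> (\<forall>x\<in>A. 0 < x \<longrightarrow> p x \<in> A \<and> p x < x)"

lemma parent_graph_simps [simp]:
  "pverts (parent_graph p A) = A"
  "(x, y) \<in> parcs (parent_graph p A) \<longleftrightarrow>
     x \<in> A \<and> y \<in> A \<and> (p y = x \<and> x < y \<or> p x = y \<and> y < x)"
  by (auto simp: parent_graph_def)

lemma pair_wf_digraph_parent_graph: "pair_wf_digraph (parent_graph p A)"
  by unfold_locales auto

lemma symmetric_parent_graph: "symmetric (with_proj (parent_graph p A))"
  by (auto simp: symmetric_def sym_def)

text \<open>Iterating \<open>p\<close> descends from any vertex to 0, and by symmetry the path can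
  be walked back.\<close>

lemma connected_parent_graph:
  assumes "parent_closed p A"
  shows "connected (with_proj (parent_graph p A))"
proof -
  let ?G = "with_proj (parent_graph p A)"
  interpret pair_sym_digraph "parent_graph p A"
    using pair_wf_digraph_parent_graph symmetric_parent_graph
    by (intro pair_sym_digraph.intro pair_sym_digraph_axioms.intro)
  have root: "x \<rightarrow>\<^sup>*\<^bsub>?G\<^esub> 0" if "x \<in> A" for x
    using that
  proof (induction x rule: less_induct)
    case (less x)
    show ?case
    proof (cases "x = 0")
      case False
      then have "p x \<in> A" "p x < x"
        using assms less.prems by (auto simp: parent_closed_def)
      then have "(x, p x) \<in> parcs (parent_graph p A)"
        using less.prems by simp
      moreover have "p x \<rightarrow>\<^sup>*\<^bsub>?G\<^esub> 0"
        using \<open>p x < x\<close> \<open>p x \<in> A\<close> by (rule less.IH)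
      ultimately show ?thesis
        by (rule adj_reachable_trans)
    qed (use less.prems in auto)
  qed
  have "strongly_connected ?G"
  proof (rule strongly_connectedI)
    show "verts ?G \<noteq> {}"
      using assms by (auto simp: parent_closed_def)
    show "u \<rightarrow>\<^sup>*\<^bsub>?G\<^esub> v" if "u \<in> verts ?G" "v \<in> verts ?G" for u v
      using reachable_trans[OF root symmetric_reachable'[OF root]] that by simp
  qed
  \<comment> \<open>\<open>connected\<close> refers to the symmetric closure, which here is the
    graph itself.\<close>
  moreover have "mk_symmetric ?G = parent_graph p A"
    by (auto simp: mk_symmetric_def parent_graph_def)
  ultimately show ?thesis
    by (simp add: connected_def)
qed

text \<open>Turns the distinctness condition in the definition of \<open>cycle\<close> into one on
  the heads of the arcs, so that cycles can be treated by indices.\<close>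

lemma tl_pawalk_verts: "pcas u p v \<Longrightarrow> tl (pawalk_verts u p) = map snd p"
proof (induction p arbitrary: u)
  case (Cons e p)
  then show ?case
    by (cases p) auto
qed simp

lemma pcas_nth:
  "pcas u p v \<Longrightarrow> i < length p \<Longrightarrow> fst (p ! i) = (if i = 0 then u else snd (p ! (i - 1)))"
proof (induction p arbitrary: u i)
  case (Cons e p)
  then show ?case
    by (cases i) (auto split: if_splits)
qed simp

lemma pcas_last: "pcas u p v \<Longrightarrow> p \<noteq> [] \<Longrightarrow> snd (last p) = v"
  by (induction p arbitrary: u) auto

text \<open>The two neighbours of the largest vertex of a cycle are both its parent.\<close>

lemma no_cycle_parent_graph:
  assumes "pre_digraph.cycle (with_proj (parent_graph p A)) c"
  shows "length c < 3"
proof (rule ccontr)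
  assume "\<not> length c < 3"
  define m where "m = length c"
  have m: "3 \<le> m"
    using \<open>\<not> length c < 3\<close> by (simp add: m_def)
  obtain u where arcs: "set c \<subseteq> parcs (parent_graph p A)" and cas: "pcas u c u"
    and "distinct (tl (pawalk_verts u c))" and "c \<noteq> []"
    using assms
    by (auto simp: pre_digraph.cycle_def pre_digraph.awalk_def cas_with_proj_eq awalk_verts_with_proj_eq)
  then have "distinct (map snd c)"
    using tl_pawalk_verts by fastforce
  then have inj: "snd (c ! i) \<noteq> snd (c ! j)" if "i < m" "j < m" "i \<noteq> j" for i j
    using that by (auto simp: distinct_conv_nth m_def)
  \<comment> \<open>Cyclic predecessor of an index: the tail of each arc is the head of the
    preceding one.\<close>
  define pred where "pred i = (if i = 0 then m - 1 else i - 1)" for i :: nat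
  have fst_nth: "fst (c ! i) = snd (c ! pred i)" if "i < m" for i
    using pcas_nth[OF cas] pcas_last[OF cas] that \<open>c \<noteq> []\<close>
    by (auto simp: pred_def m_def last_conv_nth)
  have arc: "(snd (c ! pred i), snd (c ! i)) \<in> parcs (parent_graph p A)" if "i < m" for i
  proof -
    have "c ! i \<in> parcs (parent_graph p A)"
      using arcs that by (auto simp: m_def)
    then show ?thesis
      using fst_nth[OF that] by (metis prod.collapse)
  qed
  have "Max ((\<lambda>j. snd (c ! j)) ` {..<m}) \<in> (\<lambda>j. snd (c ! j)) ` {..<m}"
    using m by (intro Max_in) (auto simp: lessThan_empty_iff)
  then obtain i where i: "i < m" and "snd (c ! i) = Max ((\<lambda>j. snd (c ! j)) ` {..<m})"
    by auto
  then have max: "snd (c ! j) \<le> snd (c ! i)" if "j < m" for j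
    using that by simp
  \<comment> \<open>The cyclic successor of \<open>i\<close>. Because \<open>m\<close> is at least
    3, it differs from \<open>pred i\<close>.\<close>
  define j where "j = (if Suc i = m then 0 else Suc i)"
  have j: "j < m" "pred j = i" "j \<noteq> i" "pred i < m" "pred i \<noteq> i" "pred i \<noteq> j"
    using i m by (auto simp: j_def pred_def split: if_splits)
  have "snd (c ! j) = p (snd (c ! i))"
    using arc[OF j(1)] max[OF j(1)] inj[OF j(1) i j(3)] j(2) by auto
  moreover have "snd (c ! pred i) = p (snd (c ! i))"
    using arc[OF i] max[OF j(4)] by auto
  ultimately show False
    using inj[OF j(4) j(1) j(6)] by simp
qed

lemma undirected_tree_parent_graph:
  assumes "finite A" "parent_closed p A"
  shows "undirected_tree (parent_graph p A)"
proof -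
  interpret pair_sym_digraph "parent_graph p A"
    using pair_wf_digraph_parent_graph symmetric_parent_graph
    by (intro pair_sym_digraph.intro pair_sym_digraph_axioms.intro)
  have "parcs (parent_graph p A) \<subseteq> A \<times> A"
    by auto
  then have "finite (parcs (parent_graph p A))"
    using assms(1) finite_subset by blast
  then have "pair_graph (parent_graph p A)"
    using assms(1) by unfold_locales auto
  then show ?thesis
    using connected_parent_graph[OF assms(2)] no_cycle_parent_graph
    unfolding undirected_tree_def by (meson not_less)
qed

lemma subtree_parent_graph:
  assumes "B \<subseteq> A" "parent_closed p B"
  shows "subtree (parent_graph p B) (parent_graph p A)"
  unfolding subtree_def subgraph_def wf_digraph_wp_iff
  using assms
  by (auto simp: pair_wf_digraph_parent_graph symmetric_parent_graph connected_parent_graph)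

lemma out_degree_parent_graph:
  "out_degree (with_proj (parent_graph p A)) x =
     card {y. (x, y) \<in> parcs (parent_graph p A)}"
proof -
  have "out_arcs (with_proj (parent_graph p A)) x =
      Pair x ` {y. (x, y) \<in> parcs (parent_graph p A)}"
    by (auto simp: out_arcs_def)
  then show ?thesis
    unfolding out_degree_def by (metis (no_types) card_image inj_onI prod.inject)
qed

section \<open>Spiders\<close>

text \<open>The legs are the colour classes of \<open>f\<close> on the positive numbers, in increasing order from the
  centre 0.\<close>

definition leg_parent :: "(nat \<Rightarrow> nat) \<Rightarrow> nat \<Rightarrow> nat" where
  "leg_parent f x = Max (insert 0 {y. 0 < y \<and> y < x \<and> f y = f x})"

lemma leg_parent_cases:
  obtains "leg_parent f x = 0"
  | "0 < leg_parent f x" "leg_parent f x < x" "f (leg_parent f x) = f x"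
proof -
  have "leg_parent f x \<in> insert 0 {y. 0 < y \<and> y < x \<and> f y = f x}"
    unfolding leg_parent_def by (rule Max_in) auto
  then show ?thesis
    using that by auto
qed

lemma leg_parent_ge: "0 < y \<Longrightarrow> y < x \<Longrightarrow> f y = f x \<Longrightarrow> y \<le> leg_parent f x"
  unfolding leg_parent_def by (rule Max_ge) auto

lemma leg_parent_less: "0 < x \<Longrightarrow> leg_parent f x < x"
  by (rule leg_parent_cases[of f x]) auto

text \<open>The leaves are the outer ends of the legs, one for each colour; with at least two legs
  the centre is not a leaf.\<close>

lemma card_leaves_spider:
  assumes "2 \<le> card (f ` {1..n})"
  shows "card (leaves (parent_graph (leg_parent f) {..n})) = card (f ` {1..n})"
proof -
  let ?G = "parent_graph (leg_parent f) {..n}"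
  let ?last = "{x \<in> {1..n}. \<forall>y\<in>{1..n}. f y = f x \<longrightarrow> y \<le> x}"
  define nbrs where "nbrs x = {y. (x, y) \<in> parcs ?G}" for x
  have centre: "card (nbrs 0) \<noteq> 1"
  proof
    assume "card (nbrs 0) = 1"
    then obtain z where z: "nbrs 0 = {z}"
      by (auto simp: card_1_singleton_iff)
    \<comment> \<open>The first vertex of the leg of colour \<open>c\<close> is adjacent to the
      centre, so it is \<open>z\<close>; all colours would then coincide.\<close>
    have "c = f z" if "c \<in> f ` {1..n}" for c
    proof -
      define x where "x = (LEAST x. x \<in> {1..n} \<and> f x = c)"
      have "x \<in> {1..n} \<and> f x = c"
        unfolding x_def by (rule LeastI_ex) (use that in auto)
      moreover have "\<not> (y \<in> {1..n} \<and> f y = c)" if "y < x" for y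
        using that not_less_Least unfolding x_def by blast
      ultimately have "leg_parent f x = 0" "x \<in> {1..n}" "f x = c"
        by (rule_tac leg_parent_cases[of f x]; auto)+
      then have "x \<in> nbrs 0" "f x = c"
        by (auto simp: nbrs_def)
      then show ?thesis
        using z by simp
    qed
    then have "f ` {1..n} \<subseteq> {f z}"
      by blast
    then have "card (f ` {1..n}) \<le> card {f z}"
      by (intro card_mono) auto
    then show False
      using assms by simp
  qed
  have leg: "card (nbrs x) = 1 \<longleftrightarrow> x \<in> ?last" if x: "x \<in> {1..n}" for x
  proof -
    have par: "leg_parent f x \<in> nbrs x"
      using leg_parent_less[of x f] x by (auto simp: nbrs_def)
    show ?thesis
    proof
      assume "card (nbrs x) = 1"
      then have nbrs: "nbrs x = {leg_parent f x}"
        using par by (auto simp: card_1_singleton_iff)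
      have "y \<le> x" if y: "y \<in> {1..n}" "f y = f x" for y
      proof (rule ccontr)
        assume "\<not> y \<le> x"
        \<comment> \<open>The next vertex after \<open>x\<close> on its leg. Its parent is
          \<open>x\<close>, which gives \<open>x\<close> a second neighbour.\<close>
        define z where "z = (LEAST z. x < z \<and> z \<in> {1..n} \<and> f z = f x)"
        have z: "x < z \<and> z \<in> {1..n} \<and> f z = f x"
          unfolding z_def by (rule LeastI[of _ y]) (use y \<open>\<not> y \<le> x\<close> in auto)
        have least: "\<not> (x < w \<and> w \<in> {1..n} \<and> f w = f x)" if "w < z" for w
          using that not_less_Least unfolding z_def by blast
        have "x \<le> leg_parent f z"
          using z x by (intro leg_parent_ge) auto
        moreover have "leg_parent f z < z"
          using z by (intro leg_parent_less) auto
        moreover have "f (leg_parent f z) = f z"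
          by (rule leg_parent_cases[of f z]) (use calculation x in auto)
        ultimately have "leg_parent f z = x"
          using least[of "leg_parent f z"] z by fastforce
        then have "z \<in> nbrs x"
          using z x by (auto simp: nbrs_def)
        then show False
          using nbrs leg_parent_less[of x f] x z by auto
      qed
      then show "x \<in> ?last"
        using x by blast
    next
      assume last: "x \<in> ?last"
      have "y = leg_parent f x" if "y \<in> nbrs x" for y
      proof (rule ccontr)
        assume "y \<noteq> leg_parent f x"
        then have y: "leg_parent f y = x" "x < y" "y \<le> n"
          using that by (auto simp: nbrs_def)
        \<comment> \<open>The parent \<open>x\<close> of \<open>y\<close> is positive, so the case
          of the centre is excluded and \<open>y\<close> lies on the same leg.\<close>
        then have "f y = f x"
          by (rule_tac leg_parent_cases[of f y]) (use x in auto)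
        then show False
          using y last by fastforce
      qed
      then have "nbrs x = {leg_parent f x}"
        using par by blast
      then show "card (nbrs x) = 1"
        by simp
    qed
  qed
  have "leaves ?G = ?last"
  proof (rule set_eqI)
    fix x
    show "x \<in> leaves ?G \<longleftrightarrow> x \<in> ?last"
      using centre leg[of x] unfolding leaves_def out_degree_parent_graph nbrs_def[symmetric]
      by (cases "x = 0") auto
  qed
  moreover have "f ` {1..n} \<subseteq> f ` ?last"
  proof
    fix c assume "c \<in> f ` {1..n}"
    then have ne: "{x \<in> {1..n}. f x = c} \<noteq> {}"
      by auto
    let ?x = "Max {x \<in> {1..n}. f x = c}"
    have "?x \<in> {x \<in> {1..n}. f x = c}"
      using ne by (intro Max_in) auto
    moreover have "y \<le> ?x" if "y \<in> {1..n}" "f y = c" for y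
      using that by (intro Max_ge) auto
    ultimately show "c \<in> f ` ?last"
      by (intro image_eqI[of _ _ ?x]) auto
  qed
  then have "f ` ?last = f ` {1..n}"
    by blast
  \<comment> \<open>Two outer ends of the same colour are each at most the other.\<close>
  moreover have "inj_on f ?last"
    by (rule inj_onI) (simp add: antisym)
  ultimately show ?thesis
    by (metis (no_types, lifting) card_image)
qed

section \<open>The catch-tree representation in the spider\<close>

theorem theorem8:
  fixes D :: "'v pair_pre_digraph"
  assumes "pair_fin_digraph D"
    and "pverts D \<noteq> {}"
    and "width (incidence_poset D) \<ge> 2"
  shows "catch_leafage D \<le> width (incidence_poset D)"
proof -
  define P where "P = incidence_poset D"
  define n where "n = card P"
  have "finite (pverts D)"
    using assms(1) by (rule pair_fin_digraph.pair_finite_verts)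
  then have fin: "finite P"
    by (simp add: P_def incidence_poset_def)
  obtain f :: "'v set \<Rightarrow> nat" where f: "f ` P = {..<width P}"
    and chain: "\<And>X Y. X \<in> P \<Longrightarrow> Y \<in> P \<Longrightarrow> f X = f Y \<Longrightarrow> X \<subseteq> Y \<or> Y \<subseteq> X"
    using chain_partition[OF fin] by metis
  obtain e :: "'v set \<Rightarrow> nat" where bij: "bij_betw e P {1..n}"
    and anti: "\<And>X Y. X \<in> P \<Longrightarrow> Y \<in> P \<Longrightarrow> X \<subset> Y \<Longrightarrow> e Y < e X"
    using reverse_linear_extension[OF fin] unfolding n_def by metis
  have inj: "inj_on e P" and img: "e ` P = {1..n}"
    using bij by (auto simp: bij_betw_def)
  \<comment> \<open>Transfers the chain colouring from the sets to their numbers.\<close>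
  define g where "g = f \<circ> inv_into P e"
  have g_e: "g (e X) = f X" if "X \<in> P" for X
    using that inj by (simp add: g_def)
  have g_img: "g ` {1..n} = {..<width P}"
    unfolding img[symmetric] image_image f[symmetric] using g_e by (intro image_cong) auto
  define T where "T = parent_graph (leg_parent g) {..n}"
  \<comment> \<open>Vertex set of the source subtree of \<open>u\<close>.\<close>
  define B where "B u = insert 0 (e ` {X \<in> P. u \<in> X})" for u
  define S where "S u = parent_graph (leg_parent g) (B u)" for u
  have "parent_closed (leg_parent g) {..n}"
    unfolding parent_closed_def using leg_parent_less[of _ g]
    by (auto intro: order_trans[OF less_imp_le])
  then have T: "undirected_tree T"
    unfolding T_def by (intro undirected_tree_parent_graph) auto
  have B_closed: "parent_closed (leg_parent g) (B u)" for u
    unfolding parent_closed_def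
  proof (intro conjI ballI impI)
    fix x assume "x \<in> B u" and "0 < x"
    then obtain X where X: "X \<in> P" "u \<in> X" "x = e X"
      by (auto simp: B_def)
    show "leg_parent g x < x"
      using \<open>0 < x\<close> by (rule leg_parent_less)
    show "leg_parent g x \<in> B u"
    proof (rule leg_parent_cases[of g x])
      assume par: "0 < leg_parent g x" "leg_parent g x < x" "g (leg_parent g x) = g x"
      have "x \<le> n"
        using X img by auto
      then have "leg_parent g x \<in> e ` P"
        using par img by simp
      then obtain Y where Y: "Y \<in> P" "leg_parent g x = e Y"
        by blast
      then have "f X = f Y"
        using par g_e X by simp
      \<comment> \<open>Both sets lie in one chain, and a proper inclusion of \<open>Y\<close> in
        \<open>X\<close> would give \<open>e X < e Y\<close>. So the next set towards the centre
        still contains \<open>u\<close>.\<close>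
      then have "X \<subseteq> Y"
        using chain[OF X(1) Y(1)] anti[OF Y(1) X(1)] par X Y by auto
      then show ?thesis
        using X Y by (auto simp: B_def)
    qed (simp add: B_def)
  qed (simp add: B_def)
  have "B u \<subseteq> {..n}" for u
    using img by (auto simp: B_def)
  then have S: "subtree (S u) T" for u
    unfolding S_def T_def using B_closed by (rule subtree_parent_graph)
  have pred_P: "predecessors D v \<in> P" if "v \<in> pverts D" for v
    using that by (simp add: P_def incidence_poset_def)
  have e_range: "e X \<in> {1..n}" if "X \<in> P" for X
    using that img by blast
  have "catch_tree_rep D T S (\<lambda>v. e (predecessors D v))"
    unfolding catch_tree_rep_def
  proof (intro conjI ballI)
    fix u v assume u: "u \<in> pverts D" and v: "v \<in> pverts D"
    \<comment> \<open>Numbers of sets are positive, so the sink point is never the centre, and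
      injectivity of \<open>e\<close> recovers the set from its vertex.\<close>
    have "e (predecessors D v) \<in> B u \<longleftrightarrow> u \<in> predecessors D v"
      using pred_P[OF v] e_range[OF pred_P[OF v]] inj by (auto simp: B_def dest: inj_onD)
    then show "(u, v) \<in> parcs D \<longleftrightarrow> e (predecessors D v) \<in> pverts (S u)"
      using u by (simp add: S_def predecessors_def)
  qed (use S e_range pred_P in \<open>auto simp: T_def\<close>)
  moreover have "card (leaves T) = width P"
    using card_leaves_spider[of g n] assms(3) g_img by (simp add: T_def P_def)
  ultimately have "catch_leafage D \<le> width P"
    unfolding catch_leafage_def using T by (intro Least_le) blast
  then show ?thesis
    by (simp add: P_def)
qed

end
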